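(* The $k$-fold \textsc{Forrelation} problem is solvable, with error probability $0.4$, using $\lceil k/2\rceil$ quantum queries to the functions $f_1,\ldots,f_k:\{0,1\}^n\to\{-1,1\}$, as well as $O(nk)$ quantum gates.
   Context: For $f_1,\ldots,f_k:\{0,1\}^n\to\{-1,1\}$ define $$\Phi_{f_1,\ldots,f_k}:=\frac{1}{2^{(k+1)n/2}}\sum_{x_1,\ldots,x_k\in\{0,1\}^n}f_1(x_1)(-1)^{x_1\cdot x_2}f_2(x_2)(-1)^{x_2\cdot x_3}\cdots(-1)^{x_{k-1}\cdot x_k}f_k(x_k).$$ The $k$-fold \textsc{Forrelation} problem is to decide, given black-box access to $f_1,\ldots,f_k$, whether $|\Phi_{f_1,\ldots,f_k}|\le\frac{1}{100}$ or $\Phi_{f_1,\ldots,f_k}\ge\frac35$, promised that one of these is the case. The input is the combined truth table $z\in\{-1,1\}^{k2^n}$ of $f_1,\ldots,f_k$, indexed by pairs $(i,x)$ with $i\in[k]$, $x\in\{0,1\}^n$; a quantum query applies the diagonal unitary $|i,x,w\rangle\mapsto f_i(x)|i,x,w\rangle$, where $w$ is a workspace register (so in a single query the index $i$ may be in superposition), and the unitaries applied between queries do not depend on the $f_i$.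
   Formalization: A quantum query is taken to allow an extra null index on which it acts as the identity (controlled queries); with only indices in [k], the claim fails for odd k such as k = 3. Quantum gates are arbitrary one- and two-qubit unitaries. *)

theory Defs
  imports "HOL-Analysis.Analysis" "HOL-Library.Log_Nat"
begin

definition cube :: "nat \<Rightarrow> bool list set" where
  "cube n = {x. length x = n}"

definition dot :: "bool list \<Rightarrow> bool list \<Rightarrow> nat" where
  "dot x y = (\<Sum>j<length x. of_bool (x ! j \<and> y ! j))"


subsection \<open>The Forrelation problem\<close>

text \<open>The functions are numbered from 1: \<open>f i x\<close> is relevant only for \<open>1 \<le> i \<le> k\<close>
  and \<open>x \<in> cube n\<close>.\<close>

definition boolean_functions :: "nat \<Rightarrow> nat \<Rightarrow> (nat \<Rightarrow> bool list \<Rightarrow> real) \<Rightarrow> bool" where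
  "boolean_functions n k f \<longleftrightarrow> (\<forall>i\<in>{1..k}. \<forall>x\<in>cube n. f i x \<in> {-1, 1})"

definition forrelation :: "nat \<Rightarrow> nat \<Rightarrow> (nat \<Rightarrow> bool list \<Rightarrow> real) \<Rightarrow> real" where
  "forrelation n k f =
     (\<Sum>x \<in> {1..k} \<rightarrow>\<^sub>E cube n.
        (\<Prod>i=1..k. f i (x i)) * (\<Prod>i=1..<k. (-1) ^ dot (x i) (x (i + 1))))
     / 2 powr (real ((k + 1) * n) / 2)"


subsection \<open>Quantum query algorithms\<close>

text \<open>A pure state of \<open>N\<close> qubits is given by its amplitudes on the computational basis
  states \<open>cube N\<close>; values outside \<open>cube N\<close> are irrelevant.\<close>

type_synonym state = "bool list \<Rightarrow> complex"

definition unitary :: "complex^'a^'a \<Rightarrow> bool" where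
  "unitary U \<longleftrightarrow> map_matrix cnj (transpose U) ** U = mat 1"

datatype step =
    Gate1 nat "complex^bool^bool"
  | Gate2 nat nat "complex^(bool \<times> bool)^(bool \<times> bool)"
  | Query

text \<open>The basis states are \<open>|i,x,w\<rangle>\<close>: the first \<open>floorlog 2 k\<close> qubits (the number of bits
  needed to write the numbers \<open>0, \<dots>, k\<close>) hold \<open>i\<close> in binary, least significant bit first,
  the next \<open>n\<close> qubits hold \<open>x\<close>, and the remaining ones are the workspace. A query acts
  trivially on basis states whose index register does not contain an element of
  \<open>{1..k}\<close>; in particular, \<open>i = 0\<close> makes controlled queries possible.\<close>

definition query_index :: "nat \<Rightarrow> bool list \<Rightarrow> nat" where
  "query_index k b = horner_sum of_bool 2 (take (floorlog 2 k) b)"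

definition query_point :: "nat \<Rightarrow> nat \<Rightarrow> bool list \<Rightarrow> bool list" where
  "query_point n k b = take n (drop (floorlog 2 k) b)"

definition query_phase ::
    "nat \<Rightarrow> nat \<Rightarrow> (nat \<Rightarrow> bool list \<Rightarrow> real) \<Rightarrow> bool list \<Rightarrow> complex" where
  "query_phase n k f b =
     (if query_index k b \<in> {1..k}
      then complex_of_real (f (query_index k b) (query_point n k b)) else 1)"

fun apply_step ::
    "nat \<Rightarrow> nat \<Rightarrow> (nat \<Rightarrow> bool list \<Rightarrow> real) \<Rightarrow> step \<Rightarrow> state \<Rightarrow> state" where
  "apply_step n k f (Gate1 q U) \<psi> = (\<lambda>b. (U *v (\<chi> c. \<psi> (b[q := c]))) $ (b ! q))"
| "apply_step n k f (Gate2 p q U) \<psi> =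
     (\<lambda>b. (U *v (\<chi> c. \<psi> (b[p := fst c, q := snd c]))) $ (b ! p, b ! q))"
| "apply_step n k f Query \<psi> = (\<lambda>b. query_phase n k f b * \<psi> b)"

fun valid_step :: "nat \<Rightarrow> step \<Rightarrow> bool" where
  "valid_step N (Gate1 q U) \<longleftrightarrow> q < N \<and> unitary U"
| "valid_step N (Gate2 p q U) \<longleftrightarrow> p < N \<and> q < N \<and> p \<noteq> q \<and> unitary U"
| "valid_step N Query \<longleftrightarrow> True"

text \<open>An algorithm starts in the all-zero basis state, performs its steps in order and
  finally measures one qubit in the computational basis; outcome 1 means "yes".\<close>

record algorithm =
  num_qubits :: nat
  steps :: "step list"
  out_qubit :: nat

definition valid_algorithm :: "nat \<Rightarrow> nat \<Rightarrow> algorithm \<Rightarrow> bool" where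
  "valid_algorithm n k A \<longleftrightarrow>
     floorlog 2 k + n \<le> num_qubits A \<and> out_qubit A < num_qubits A \<and>
     (\<forall>s\<in>set (steps A). valid_step (num_qubits A) s)"

definition num_queries :: "algorithm \<Rightarrow> nat" where
  "num_queries A = length (filter (\<lambda>s. s = Query) (steps A))"

definition num_gates :: "algorithm \<Rightarrow> nat" where
  "num_gates A = length (filter (\<lambda>s. s \<noteq> Query) (steps A))"

definition final_state ::
    "nat \<Rightarrow> nat \<Rightarrow> algorithm \<Rightarrow> (nat \<Rightarrow> bool list \<Rightarrow> real) \<Rightarrow> state" where
  "final_state n k A f =
     fold (apply_step n k f) (steps A) (\<lambda>b. of_bool (b = replicate (num_qubits A) False))"

definition output_prob ::
    "nat \<Rightarrow> nat \<Rightarrow> algorithm \<Rightarrow> (nat \<Rightarrow> bool list \<Rightarrow> real) \<Rightarrow> bool \<Rightarrow> real" where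
  "output_prob n k A f v =
     (\<Sum>b \<in> {b \<in> cube (num_qubits A). b ! out_qubit A = v}. (cmod (final_state n k A f b))\<^sup>2)"

definition solves_forrelation :: "nat \<Rightarrow> nat \<Rightarrow> real \<Rightarrow> algorithm \<Rightarrow> bool" where
  "solves_forrelation n k \<epsilon> A \<longleftrightarrow>
     (\<forall>f. boolean_functions n k f \<longrightarrow>
        (forrelation n k f \<ge> 3 / 5 \<longrightarrow> output_prob n k A f False \<le> \<epsilon>) \<and>
        (\<bar>forrelation n k f\<bar> \<le> 1 / 100 \<longrightarrow> output_prob n k A f True \<le> \<epsilon>))"

end

theory Submission
  imports Defs
begin

text \<open>
  Write \<open>H\<close> for the Hadamard transform on \<open>n\<close> qubits and \<open>f\<close> also for multiplication by \<open>f\<close>.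
  Since \<open>H\<close> and these multiplications are self-adjoint, with \<open>m = \<lceil>k/2\<rceil>\<close> we have
  \<open>\<Phi> = \<langle>v|w\<rangle>\<close> for the unit vectors \<open>v = f\<^sub>m H \<dots> f\<^sub>1 H |0\<rangle>\<close> and
  \<open>w = H f\<^bsub>m+1\<^esub> H \<dots> f\<^sub>k H |0\<rangle>\<close>. A control qubit in superposition lets \<open>m\<close> queries
  prepare both; for odd \<open>k\<close> the last query is idle in the second branch.

  Rotating the control qubit by \<open>\<pi>/6\<close> before and after gives the amplitude \<open>\<surd>3/4 (v + w)\<close> on
  outcome 1, which has probability \<open>3/8 (1 + \<Phi>)\<close>. Two unequal branches thus do what
  would otherwise take an extra biased coin: this is at least \<open>3/5\<close> if \<open>\<Phi> \<ge> 3/5\<close> and less than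
  \<open>2/5\<close> if \<open>\<bar>\<Phi>\<bar> \<le> 1/100\<close>.

  Between queries the index register goes from \<open>i\<close> to \<open>i \<plusminus> 1\<close>. Flipping only the bits that differ
  costs amortised \<open>O(1)\<close> gates, as in a binary counter; rewriting the whole register would cost
  \<open>k log k\<close> gates, too many for small \<open>n\<close>.
\<close>

section \<open>Real orthogonal gates and their controlled versions\<close>

definition rmat :: "('a::finite \<Rightarrow> 'a \<Rightarrow> real) \<Rightarrow> complex^'a^'a" where
  "rmat g = (\<chi> i j. complex_of_real (g i j))"

text \<open>The block matrix that applies \<open>g\<close> to the second qubit if the first holds
  \<open>s\<close>. Both values of \<open>s\<close> occur, since each branch is driven by its own
  value of the same control qubit.\<close>

definition ctrl :: "bool \<Rightarrow> (bool \<Rightarrow> bool \<Rightarrow> real) \<Rightarrow> bool \<times> bool \<Rightarrow> bool \<times> bool \<Rightarrow> real" where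
  "ctrl s g i j = (if fst i = fst j
     then if fst i = s then g (snd i) (snd j) else of_bool (snd i = snd j) else 0)"

definition orthogonal_entries :: "('a::finite \<Rightarrow> 'a \<Rightarrow> real) \<Rightarrow> bool" where
  "orthogonal_entries g \<longleftrightarrow> (\<forall>i j. (\<Sum>k\<in>UNIV. g k i * g k j) = of_bool (i = j))"

definition not_entry :: "bool \<Rightarrow> bool \<Rightarrow> real" where
  "not_entry a b = of_bool (a \<noteq> b)"

definition hadamard_entry :: "bool \<Rightarrow> bool \<Rightarrow> real" where
  "hadamard_entry a b = (-1) ^ of_bool (a \<and> b) / sqrt 2"

definition rotation_entry :: "real \<Rightarrow> real \<Rightarrow> bool \<Rightarrow> bool \<Rightarrow> real" where
  "rotation_entry c s a b = (if a = b then c else if a then s else - s)"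

lemma unitary_rmat:
  assumes "orthogonal_entries g"
  shows "unitary (rmat g)"
  using assms
  by (simp add: unitary_def rmat_def orthogonal_entries_def vec_eq_iff matrix_matrix_mult_def
      map_matrix_def transpose_def mat_def of_bool_def flip: of_real_mult of_real_sum)

lemma sum_bool_prod:
  "(\<Sum>p\<in>(UNIV :: (bool \<times> bool) set). F p) = F (False, False) + F (False, True) + F (True, False) + (F (True, True) :: 'a::comm_monoid_add)"
proof -
  have eq: "(UNIV :: (bool \<times> bool) set) = {(False, False), (False, True), (True, False), (True, True)}"
    by auto
  show ?thesis by (subst eq) (simp add: add.assoc)
qed

lemma orthogonal_ctrl:
  assumes "orthogonal_entries g"
  shows "orthogonal_entries (ctrl s g)"
  using assms
  unfolding orthogonal_entries_def
  by (cases s) (auto simp: sum_bool_prod ctrl_def UNIV_bool all_bool_eq)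

lemma orthogonal_not: "orthogonal_entries not_entry"
  by (auto simp: orthogonal_entries_def not_entry_def UNIV_bool)

lemma orthogonal_hadamard: "orthogonal_entries hadamard_entry"
  by (auto simp: orthogonal_entries_def hadamard_entry_def UNIV_bool)

lemma orthogonal_rotation:
  assumes "c\<^sup>2 + s\<^sup>2 = 1"
  shows "orthogonal_entries (rotation_entry c s)"
  using assms by (auto simp: orthogonal_entries_def rotation_entry_def UNIV_bool power2_eq_square algebra_simps)

definition cgate :: "nat \<Rightarrow> bool \<Rightarrow> nat \<Rightarrow> (bool \<Rightarrow> bool \<Rightarrow> real) \<Rightarrow> step" where
  "cgate p s q g = Gate2 p q (rmat (ctrl s g))"

text \<open>The matrix is block diagonal in the control, so only the terms that keep
  \<open>b ! p\<close> survive.\<close>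

lemma apply_cgate:
  "apply_step n k f (cgate p s q g) \<psi> b =
     (if b ! p = s then \<Sum>c\<in>UNIV. complex_of_real (g (b ! q) c) * \<psi> (b[q := c]) else \<psi> b)"
proof -
  have id: "b[p := b ! p, q := c] = b[q := c]" for c by simp
  have id': "b[p := b ! p, q := b ! q] = b" by simp
  show ?thesis
    using id[of True] id[of False] id'
    by (cases "b ! p"; cases "b ! q"; cases s)
       (auto simp: cgate_def rmat_def ctrl_def matrix_vector_mult_def sum_bool_prod UNIV_bool)
qed

lemma apply_gate1:
  "apply_step n k f (Gate1 q (rmat g)) \<psi> b =
     (\<Sum>c\<in>UNIV. complex_of_real (g (b ! q) c) * \<psi> (b[q := c]))"
  by (simp add: rmat_def matrix_vector_mult_def)

text \<open>The control is always the last qubit; \<open>q < p\<close> yields both the range of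
  \<open>q\<close> and distinctness.\<close>

lemma valid_cgate:
  "q < p \<Longrightarrow> p < N \<Longrightarrow> orthogonal_entries g \<Longrightarrow> valid_step N (cgate p s q g)"
  by (simp add: cgate_def unitary_rmat orthogonal_ctrl)


section \<open>The two branches\<close>

text \<open>The control qubit comes last; the part of the state in which it is \<open>s\<close> has index
  register \<open>i\<close> and unnormalised amplitudes \<open>u\<close>.\<close>

definition branch :: "nat \<Rightarrow> nat \<Rightarrow> state \<Rightarrow> bool \<Rightarrow> bool list \<Rightarrow> (bool list \<Rightarrow> real) \<Rightarrow> bool" where
  "branch L n \<psi> s i u \<longleftrightarrow>
     (\<forall>a\<in>cube L. \<forall>x\<in>cube n. \<psi> (a @ x @ [s]) = of_bool (a = i) * complex_of_real (u x))"

lemma branch_cong: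
  assumes "branch L n \<psi> s i u" "\<And>x. x \<in> cube n \<Longrightarrow> u x = u' x"
  shows "branch L n \<psi> s i u'"
  using assms by (auto simp: branch_def)

lemma nth_control: "a \<in> cube L \<Longrightarrow> x \<in> cube n \<Longrightarrow> (a @ x @ [s]) ! (L + n) = s"
  by (auto simp: cube_def nth_append)

text \<open>Gates controlled on one value leave the amplitudes with the other value alone. The
  target map \<open>h\<close> covers both index shifts and Hadamard layers.\<close>

lemma branch_other:
  assumes "branch L n \<psi> s' i u" "s' \<noteq> s"
  shows "branch L n (fold (apply_step m k f) (map (\<lambda>q. cgate (L + n) s (h q) g) qs) \<psi>) s' i u"
  using assms
  by (induction qs arbitrary: \<psi>) (simp_all add: branch_def apply_cgate nth_control)

lemma branch_flip:
  assumes "branch L n \<psi> s i u" "q < L" "i \<in> cube L"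
  shows "branch L n (apply_step m k f (cgate (L + n) s q not_entry) \<psi>) s (i[q := \<not> i ! q]) u"
  unfolding branch_def
proof (intro ballI)
  fix a x assume a: "a \<in> cube L" and x: "x \<in> cube n"
  have upd: "a[q := c] \<in> cube L" for c using a by (simp add: cube_def)
  \<comment> \<open>A flip is an involution, so it can be moved from \<open>a\<close> to
    \<open>i\<close>.\<close>
  have eq: "(a[q := \<not> a ! q] = i) = (a = i[q := \<not> i ! q])"
  proof
    assume "a[q := \<not> a ! q] = i"
    then show "a = i[q := \<not> i ! q]" using a assms(2) by (auto simp: cube_def)
  next
    assume "a = i[q := \<not> i ! q]"
    then show "a[q := \<not> a ! q] = i" using assms(2,3) by (simp add: cube_def)
  qed
  have "apply_step m k f (cgate (L + n) s q not_entry) \<psi> (a @ x @ [s]) = \<psi> (a[q := \<not> a ! q] @ x @ [s])"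
    using a assms(2) nth_control[OF a x]
    by (simp add: apply_cgate UNIV_bool not_entry_def cube_def nth_append list_update_append)
  then show "apply_step m k f (cgate (L + n) s q not_entry) \<psi> (a @ x @ [s]) =
      of_bool (a = i[q := \<not> i ! q]) * complex_of_real (u x)"
    using assms(1) upd x eq by (simp add: branch_def)
qed

section \<open>Moving the index register of one branch\<close>

definition bits :: "nat \<Rightarrow> nat \<Rightarrow> bool list" where
  "bits L i = map (bit i) [0..<L]"

definition index_shift :: "nat \<Rightarrow> nat \<Rightarrow> bool \<Rightarrow> nat \<Rightarrow> nat \<Rightarrow> step list" where
  "index_shift L n s i j =
     map (\<lambda>q. cgate (L + n) s q not_entry) (filter (\<lambda>q. bit i q \<noteq> bit j q) [0..<L])"

lemma branch_index_shift:
  assumes "branch L n \<psi> s (bits L i) u"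
  shows "branch L n (fold (apply_step m k f) (index_shift L n s i j) \<psi>) s (bits L j) u"
proof -
  \<comment> \<open>the register after the bits below \<open>r\<close> have been processed\<close>
  let ?mix = "\<lambda>r. map (\<lambda>q. if q < r then bit j q else bit i q) [0..<L]"
  have mixed: "branch L n (fold (apply_step m k f) (map (\<lambda>q. cgate (L + n) s q not_entry)
          (filter (\<lambda>q. bit i q \<noteq> bit j q) [0..<r])) \<psi>) s (?mix r) u" if "r \<le> L" for r
    using that
  proof (induction r)
    case 0
    then show ?case using assms by (simp add: bits_def)
  next
    case (Suc r)
    let ?\<psi> = "fold (apply_step m k f) (map (\<lambda>q. cgate (L + n) s q not_entry)
          (filter (\<lambda>q. bit i q \<noteq> bit j q) [0..<r])) \<psi>"
    have IH: "branch L n ?\<psi> s (?mix r) u" using Suc by simp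
    show ?case
    proof (cases "bit i r = bit j r")
      case True
      then have "?mix (Suc r) = ?mix r" by (auto simp: less_Suc_eq)
      moreover have "filter (\<lambda>q. bit i q \<noteq> bit j q) [0..<Suc r] = filter (\<lambda>q. bit i q \<noteq> bit j q) [0..<r]"
        using True by simp
      ultimately show ?thesis using IH by (simp only:)
    next
      case False
      then have "?mix (Suc r) = (?mix r)[r := \<not> ?mix r ! r]"
        using Suc.prems by (auto intro!: nth_equalityI simp: less_Suc_eq nth_list_update)
      then show ?thesis
        using branch_flip[OF IH, of r] Suc.prems False by (simp add: cube_def)
    qed
  qed
  have "?mix L = bits L j" by (simp add: bits_def)
  then show ?thesis using mixed[OF order_refl] unfolding index_shift_def by (simp only:)
qed

lemma branch_index_shift_other:
  "branch L n \<psi> s' i' u \<Longrightarrow> s' \<noteq> s \<Longrightarrow>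
     branch L n (fold (apply_step m k f) (index_shift L n s i j) \<psi>) s' i' u"
  unfolding index_shift_def by (rule branch_other)

section \<open>Controlled Hadamard layers and sums over the cube\<close>

definition hadamard :: "nat \<Rightarrow> (bool list \<Rightarrow> real) \<Rightarrow> bool list \<Rightarrow> real" where
  "hadamard n u x = (\<Sum>y\<in>cube n. (-1) ^ dot x y * u y) / sqrt 2 ^ n"

definition hadamard_layer :: "nat \<Rightarrow> nat \<Rightarrow> bool \<Rightarrow> step list" where
  "hadamard_layer L n s = map (\<lambda>q. cgate (L + n) s (L + q) hadamard_entry) [0..<n]"

lemma finite_cube [simp]: "finite (cube n)"
  using finite_lists_length_eq[of "UNIV :: bool set" n] by (simp add: cube_def)

lemma cube_0: "cube 0 = {[]}"
  by (auto simp: cube_def)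

lemma sum_cube_Suc:
  "(\<Sum>x\<in>cube (Suc n). F x) = (\<Sum>c\<in>UNIV. \<Sum>x\<in>cube n. F (c # x))" for F :: "bool list \<Rightarrow> 'a::comm_monoid_add"
proof -
  have "(\<Sum>x\<in>cube (Suc n). F x) = (\<Sum>p\<in>UNIV \<times> cube n. F (fst p # snd p))"
    by (rule sum.reindex_bij_witness[of _ "\<lambda>p. fst p # snd p" "\<lambda>x. (hd x, tl x)"])
       (auto simp: cube_def length_Suc_conv)
  then show ?thesis by (simp add: sum.cartesian_product split_def)
qed

lemma sum_cube_Suc_snoc:
  "(\<Sum>x\<in>cube (Suc n). F x) = (\<Sum>c\<in>UNIV. \<Sum>x\<in>cube n. F (x @ [c]))" for F :: "bool list \<Rightarrow> 'a::comm_monoid_add"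
proof -
  have "(\<Sum>x\<in>cube (Suc n). F x) = (\<Sum>p\<in>UNIV \<times> cube n. F (snd p @ [fst p]))"
    by (rule sum.reindex_bij_witness[of _ "\<lambda>p. snd p @ [fst p]" "\<lambda>x. (last x, butlast x)"])
       (auto simp: cube_def length_Suc_conv_rev)
  then show ?thesis by (simp add: sum.cartesian_product split_def)
qed

lemma sum_cube_append:
  "(\<Sum>x\<in>cube (m + n). F x) = (\<Sum>x\<in>cube m. \<Sum>y\<in>cube n. F (x @ y))" for F :: "bool list \<Rightarrow> 'a::comm_monoid_add"
proof -
  have "(\<Sum>x\<in>cube (m + n). F x) = (\<Sum>p\<in>cube m \<times> cube n. F (fst p @ snd p))"
    by (rule sum.reindex_bij_witness[of _ "\<lambda>p. fst p @ snd p" "\<lambda>x. (take m x, drop m x)"])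
       (auto simp: cube_def)
  then show ?thesis by (simp add: sum.cartesian_product split_def)
qed

lemma dot_Cons: "dot (a # x) (b # y) = of_bool (a \<and> b) + dot x y"
  unfolding dot_def by (simp add: sum.lessThan_Suc_shift del: sum.lessThan_Suc)

lemma dot_snoc: "length x = length y \<Longrightarrow> dot (x @ [a]) (y @ [b]) = dot x y + of_bool (a \<and> b)"
  unfolding dot_def by (simp add: nth_append)

lemma dot_commute: "length x = length y \<Longrightarrow> dot x y = dot y x"
  unfolding dot_def by (simp add: conj_commute)

lemma branch_hadamard_gate:
  assumes "branch L n \<psi> s i u" "q < n"
  shows "branch L n (apply_step m k f (cgate (L + n) s (L + q) hadamard_entry) \<psi>) s i
           (\<lambda>x. \<Sum>c\<in>UNIV. hadamard_entry (x ! q) c * u (x[q := c]))"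
  unfolding branch_def
proof (intro ballI)
  fix a x assume a: "a \<in> cube L" and x: "x \<in> cube n"
  have nth: "(a @ x @ [s]) ! (L + q) = x ! q"
    using a x assms(2) by (simp add: cube_def nth_append)
  have upd: "(a @ x @ [s])[L + q := c] = a @ x[q := c] @ [s]" for c
    using a x assms(2) by (simp add: cube_def list_update_append)
  have mem: "x[q := c] \<in> cube n" for c using x by (simp add: cube_def)
  show "apply_step m k f (cgate (L + n) s (L + q) hadamard_entry) \<psi> (a @ x @ [s]) =
      of_bool (a = i) * complex_of_real (\<Sum>c\<in>UNIV. hadamard_entry (x ! q) c * u (x[q := c]))"
    using assms(1) a mem
    by (simp add: apply_cgate nth_control[OF a x] nth upd branch_def)
qed

text \<open>The transform is a tensor power of the one-qubit transform, so one gate per coordinate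
  builds it up.\<close>

lemma branch_hadamard_layer:
  assumes "branch L n \<psi> s i u"
  shows "branch L n (fold (apply_step m k f) (hadamard_layer L n s) \<psi>) s i (hadamard n u)"
proof -
  \<comment> \<open>After \<open>j\<close> gates the first \<open>j\<close> coordinates are
    transformed and the others are still those of the input.\<close>
  let ?H = "\<lambda>j x. (\<Sum>z\<in>cube j. (-1) ^ dot (take j x) z * u (z @ drop j x)) / sqrt 2 ^ j"
  have "branch L n (fold (apply_step m k f)
      (map (\<lambda>q. cgate (L + n) s (L + q) hadamard_entry) [0..<j]) \<psi>) s i (?H j)" if "j \<le> n" for j
    using that
  proof (induction j)
    case 0
    then show ?case using assms by (simp add: cube_0 dot_def)
  next
    case (Suc j)
    have upd: "take j (x[j := c]) = take j x" "drop j (x[j := c]) = c # drop (Suc j) x"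
      if "x \<in> cube n" for x :: "bool list" and c
      using that Suc.prems by (simp_all add: cube_def drop_update_swap flip: Cons_nth_drop_Suc)
    have tk: "take (Suc j) x = take j x @ [x ! j]" if "x \<in> cube n" for x
      using that Suc.prems by (simp add: cube_def take_Suc_conv_app_nth)
    have "(\<Sum>c\<in>UNIV. hadamard_entry (x ! j) c * ?H j (x[j := c])) = ?H (Suc j) x"
      if x: "x \<in> cube n" for x
    proof -
      \<comment> \<open>Gate \<open>j\<close> sums over coordinate \<open>j\<close>, the last one of
        the longer prefix; the sign splits accordingly.\<close>
      have "(-1) ^ dot (take j x @ [x ! j]) (z @ [c]) = (-1::real) ^ dot (take j x) z * (-1) ^ of_bool (x ! j \<and> c)"
        if "z \<in> cube j" for z c
        using that x Suc.prems by (subst dot_snoc) (auto simp: cube_def power_add)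
      then have "?H (Suc j) x = (\<Sum>c\<in>UNIV. \<Sum>z\<in>cube j. (-1::real) ^ dot (take j x) z *
          (-1) ^ of_bool (x ! j \<and> c) * u (z @ c # drop (Suc j) x)) / sqrt 2 ^ Suc j"
        by (simp add: sum_cube_Suc_snoc tk[OF x])
      then show ?thesis
        by (simp add: upd[OF x] hadamard_entry_def sum_divide_distrib sum_distrib_left mult_ac)
    qed
    then show ?case
      using branch_cong[OF branch_hadamard_gate[OF Suc.IH, of j]] Suc.prems by simp
  qed
  from branch_cong[OF this[of n]] show ?thesis
    by (simp add: hadamard_layer_def hadamard_def cube_def)
qed

lemma branch_hadamard_layer_other:
  "branch L n \<psi> s' i u \<Longrightarrow> s' \<noteq> s \<Longrightarrow>
     branch L n (fold (apply_step m k f) (hadamard_layer L n s) \<psi>) s' i u"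
  unfolding hadamard_layer_def by (rule branch_other)

text \<open>The factor that a query contributes to a branch at index \<open>i\<close>. Index 0 lets
  a branch stay idle.\<close>

definition phase :: "nat \<Rightarrow> (nat \<Rightarrow> bool list \<Rightarrow> real) \<Rightarrow> nat \<Rightarrow> bool list \<Rightarrow> real" where
  "phase k f i x = (if i \<in> {1..k} then f i x else 1)"

lemma branch_query:
  assumes "branch L n \<psi> s (bits L i) u" "i \<le> k" "1 \<le> k" "L = floorlog 2 k"
  shows "branch L n (apply_step n k f Query \<psi>) s (bits L i) (\<lambda>x. phase k f i x * u x)"
  unfolding branch_def
proof (intro ballI)
  fix a x assume a: "a \<in> cube L" and x: "x \<in> cube n"
  \<comment> \<open>The register is wide enough for every index up to \<open>k\<close>, so reading
    it back gives \<open>i\<close>.\<close>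
  have "k < 2 ^ L" using floorlog_bounds[of k 2] assms by simp
  then have "take_bit L i = i" using assms(2) by (simp add: take_bit_nat_eq_self)
  then have "query_index k (bits L i @ x @ [s]) = i"
    by (simp add: query_index_def bits_def horner_sum_bit_eq_take_bit flip: assms(4))
  moreover have "query_point n k (a @ x @ [s]) = x"
    using a x by (simp add: query_point_def cube_def flip: assms(4))
  ultimately show "apply_step n k f Query \<psi> (a @ x @ [s]) =
      of_bool (a = bits L i) * complex_of_real (phase k f i x * u x)"
    using assms(1) a x by (auto simp: branch_def query_phase_def phase_def)
qed


text \<open>A function on \<open>insert a A\<close> is a function on \<open>A\<close> together with
  a value at \<open>a\<close>. This splits off the last variable of a path sum.\<close>

lemma sum_PiE_insert:
  fixes F :: "('a \<Rightarrow> 'b) \<Rightarrow> 'c::comm_monoid_add"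
  assumes "a \<notin> A"
  shows "(\<Sum>x\<in>insert a A \<rightarrow>\<^sub>E B. F x) = (\<Sum>x\<in>A \<rightarrow>\<^sub>E B. \<Sum>y\<in>B. F (x(a := y)))"
proof -
  have "(\<Sum>x\<in>insert a A \<rightarrow>\<^sub>E B. F x) = (\<Sum>p\<in>B \<times> (A \<rightarrow>\<^sub>E B). F ((snd p)(a := fst p)))"
    unfolding PiE_insert_eq using inj_combinator[OF assms, of "\<lambda>_. B"]
    by (subst sum.reindex) (auto simp: case_prod_unfold)
  then show ?thesis by (subst sum.swap) (simp add: sum.cartesian_product split_def)
qed


section \<open>The Hadamard transform\<close>

lemma hadamard_scale: "hadamard n (\<lambda>x. c * u x) x = c * hadamard n u x"
  by (simp add: hadamard_def sum_distrib_left mult_ac)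

text \<open>Self-adjointness, from the symmetry of the kernel \<open>(-1) ^ dot x y\<close>.\<close>

lemma hadamard_symmetric:
  "(\<Sum>x\<in>cube n. u x * hadamard n v x) = (\<Sum>x\<in>cube n. hadamard n u x * v x)"
proof -
  have "(\<Sum>x\<in>cube n. u x * hadamard n v x) =
      (\<Sum>x\<in>cube n. \<Sum>y\<in>cube n. u x * (-1) ^ dot x y * v y / sqrt 2 ^ n)"
    by (simp add: hadamard_def sum_distrib_left sum_divide_distrib mult_ac)
  also have "\<dots> = (\<Sum>y\<in>cube n. \<Sum>x\<in>cube n. u x * (-1) ^ dot x y * v y / sqrt 2 ^ n)"
    by (rule sum.swap)
  also have "\<dots> = (\<Sum>y\<in>cube n. \<Sum>x\<in>cube n. u x * (-1) ^ dot y x * v y / sqrt 2 ^ n)"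
    by (intro sum.cong refl, subst dot_commute) (auto simp: cube_def)
  also have "\<dots> = (\<Sum>y\<in>cube n. hadamard n u y * v y)"
    by (simp add: hadamard_def sum_distrib_left sum_distrib_right sum_divide_distrib mult_ac)
  finally show ?thesis .
qed

text \<open>The sum factors over the coordinates: a coordinate contributes 2 if the bits of
  \<open>x\<close> and \<open>z\<close> agree there, and 0 otherwise.\<close>

lemma character_orthogonality:
  assumes "length x = n" "length z = n"
  shows "(\<Sum>y\<in>cube n. (-1) ^ dot x y * (-1) ^ dot y z) = (2 ^ n * of_bool (x = z) :: real)"
  using assms
proof (induction n arbitrary: x z)
  case 0
  then show ?case by (simp add: cube_0 dot_def)
next
  case (Suc n)
  obtain a x' where x: "x = a # x'" "length x' = n" using Suc.prems(1) by (auto simp: length_Suc_conv)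
  obtain c z' where z: "z = c # z'" "length z' = n" using Suc.prems(2) by (auto simp: length_Suc_conv)
  have "(\<Sum>y\<in>cube (Suc n). (-1) ^ dot x y * (-1) ^ dot y z) =
      (\<Sum>b\<in>UNIV. (-1) ^ of_bool (a \<and> b) * (-1) ^ of_bool (b \<and> c) * (2 ^ n * of_bool (x' = z') :: real))"
    unfolding sum_cube_Suc x z dot_Cons Suc.IH[OF x(2) z(2), symmetric]
    by (simp add: power_add sum_distrib_left mult_ac)
  then show ?case by (cases a; cases c) (simp_all add: UNIV_bool x z)
qed

text \<open>After exchanging the sums, character orthogonality leaves one term, whose factor
  \<open>2 ^ n\<close> cancels the two normalisations.\<close>

lemma hadamard_involution:
  assumes "x \<in> cube n"
  shows "hadamard n (hadamard n u) x = u x"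
proof -
  have "hadamard n (hadamard n u) x =
      (\<Sum>y\<in>cube n. \<Sum>z\<in>cube n. (-1) ^ dot x y * (-1) ^ dot y z * u z / (sqrt 2 ^ n * sqrt 2 ^ n))"
    by (simp add: hadamard_def sum_distrib_left sum_divide_distrib mult_ac)
  also have "\<dots> = (\<Sum>z\<in>cube n. (\<Sum>y\<in>cube n. (-1) ^ dot x y * (-1) ^ dot y z) * u z / (sqrt 2 ^ n * sqrt 2 ^ n))"
    by (subst sum.swap) (simp add: sum_distrib_right sum_divide_distrib)
  also have "\<dots> = (\<Sum>z\<in>cube n. of_bool (x = z) * u z)"
  proof (intro sum.cong refl)
    fix z assume "z \<in> cube n"
    then have "(\<Sum>y\<in>cube n. (-1) ^ dot x y * (-1) ^ dot y z) = (2 ^ n * of_bool (x = z) :: real)"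
      using assms by (intro character_orthogonality) (simp_all add: cube_def)
    then show "(\<Sum>y\<in>cube n. (-1) ^ dot x y * (-1) ^ dot y z) * u z / (sqrt 2 ^ n * sqrt 2 ^ n) =
        of_bool (x = z) * u z"
      by (simp flip: power_mult_distrib)
  qed
  also have "\<dots> = u x" using assms by (simp add: of_bool_def if_distrib[of "\<lambda>t. t * _"] cong: if_cong)
  finally show ?thesis .
qed

text \<open>A self-adjoint involution is an isometry.\<close>

lemma hadamard_parseval: "(\<Sum>x\<in>cube n. (hadamard n u x)\<^sup>2) = (\<Sum>x\<in>cube n. (u x)\<^sup>2)"
  using hadamard_symmetric[of "hadamard n u" n u]
  by (simp add: power2_eq_square hadamard_involution)

section \<open>The vectors \<open>g r H ... g 1 H |0>\<close> and their relation to
  forrelation\<close>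

primrec run :: "nat \<Rightarrow> (nat \<Rightarrow> bool list \<Rightarrow> real) \<Rightarrow> nat \<Rightarrow> bool list \<Rightarrow> real" where
  "run n g 0 = (\<lambda>x. of_bool (x = replicate n False))"
| "run n g (Suc r) = (\<lambda>x. g (Suc r) x * hadamard n (run n g r) x)"

lemma run_cong: "(\<And>r. 1 \<le> r \<Longrightarrow> r \<le> m \<Longrightarrow> g r = g' r) \<Longrightarrow> run n g m = run n g' m"
  by (induction m) auto

lemma zero_in_cube: "replicate n False \<in> cube n"
  by (simp add: cube_def)

lemma hadamard_run_0: "x \<in> cube n \<Longrightarrow> hadamard n (run n g 0) x = 1 / sqrt 2 ^ n"
proof -
  assume "x \<in> cube n"
  then have "dot x (replicate n False) = 0" by (simp add: dot_def cube_def)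
  then show ?thesis
    by (simp add: hadamard_def of_bool_def if_distrib[of "\<lambda>t. _ * t"] zero_in_cube cong: if_cong)
qed

lemma run_norm:
  assumes "\<And>r x. 1 \<le> r \<Longrightarrow> r \<le> m \<Longrightarrow> x \<in> cube n \<Longrightarrow> (g r x)\<^sup>2 = 1"
  shows "(\<Sum>x\<in>cube n. (run n g m x)\<^sup>2) = 1"
  using assms
proof (induction m)
  case 0
  then show ?case
    by (simp add: of_bool_def if_distrib[of "\<lambda>t. t\<^sup>2"] zero_in_cube cong: if_cong)
next
  case (Suc m)
  then show ?case by (simp add: power_mult_distrib hadamard_parseval)
qed

text \<open>Moving one factor \<open>f\<^bsub>k-j\<^esub> H\<close> at a time from the right to the left of the inner product.\<close>

lemma run_meet:
  assumes "j \<le> k"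
  shows "(\<Sum>x\<in>cube n. run n f (k - j) x * hadamard n (run n (\<lambda>r. f (k + 1 - r)) j) x) =
         (\<Sum>x\<in>cube n. run n f k x) / sqrt 2 ^ n"
  using assms
proof (induction j)
  case 0
  then show ?case
    by (simp add: hadamard_run_0 sum_divide_distrib del: run.simps(1))
next
  case (Suc j)
  let ?w = "run n (\<lambda>r. f (k + 1 - r))"
  \<comment> \<open>The outermost factor of \<open>?w (Suc j)\<close> is \<open>f (k - j)\<close>,
    which becomes the last factor of the run on the left.\<close>
  have kj: "k - j = Suc (k - Suc j)" using Suc.prems by simp
  have "(\<Sum>x\<in>cube n. run n f (k - Suc j) x * hadamard n (?w (Suc j)) x) =
      (\<Sum>x\<in>cube n. hadamard n (run n f (k - Suc j)) x * (f (k - j) x * hadamard n (?w j) x))"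
    by (subst hadamard_symmetric) simp
  also have "\<dots> = (\<Sum>x\<in>cube n. run n f (k - j) x * hadamard n (?w j) x)"
    by (simp only: kj run.simps mult_ac)
  finally show ?case using Suc.IH Suc.prems by (simp only: Suc_leD)
qed

text \<open>Summing out the last variable turns a function of it into a function of the previous
  one, so the induction needs an arbitrary \<open>G\<close> at the endpoint. Each of the
  \<open>r\<close> transforms accounts for one factor \<open>sqrt 2 ^ n\<close>.\<close>

lemma path_sum:
  assumes "r \<ge> 1"
  shows "(\<Sum>x \<in> {1..r} \<rightarrow>\<^sub>E cube n.
           (\<Prod>i=1..r. f i (x i)) * (\<Prod>i=1..<r. (-1) ^ dot (x i) (x (i + 1))) * G (x r)) =
         sqrt 2 ^ (r * n) * (\<Sum>y\<in>cube n. run n f r y * G y)"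
  using assms
proof (induction r arbitrary: G rule: nat_induct_at_least)
  case base
  have "{1..1::nat} = insert 1 {}" by auto
  then show ?case
    by (simp add: sum_PiE_insert hadamard_run_0 sum_distrib_left del: run.simps(1))
next
  case (Suc r)
  have ins: "{1..Suc r} = insert (Suc r) {1..r}" "{1..<Suc r} = insert r {1..<r}"
    using Suc.hyps by auto
  \<comment> \<open>The last variable, summed out, leaves this function of the one before
    it.\<close>
  define G' where "G' z = (\<Sum>y\<in>cube n. f (Suc r) y * (-1) ^ dot z y * G y)" for z
  have key: "(\<Prod>i=1..Suc r. f i ((x(Suc r := y)) i)) *
      (\<Prod>i=1..<Suc r. (-1) ^ dot ((x(Suc r := y)) i) ((x(Suc r := y)) (i + 1))) * G y =
      (\<Prod>i=1..r. f i (x i)) * (\<Prod>i=1..<r. (-1) ^ dot (x i) (x (i + 1))) *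
      (f (Suc r) y * (-1) ^ dot (x r) y * G y)" for x y
  proof -
    have 1: "(\<Prod>i=1..r. f i ((x(Suc r := y)) i)) = (\<Prod>i=1..r. f i (x i))"
      by (intro prod.cong) auto
    have 2: "(\<Prod>i=1..<r. (-1) ^ dot ((x(Suc r := y)) i) ((x(Suc r := y)) (i + 1))) =
       (\<Prod>i=1..<r. (-1::real) ^ dot (x i) (x (i + 1)))"
      by (intro prod.cong) auto
    have 3: "(\<Prod>i\<in>{1..Suc r}. f i ((x(Suc r := y)) i)) = f (Suc r) y * (\<Prod>i=1..r. f i (x i))"
      unfolding ins by (subst prod.insert) (use 1 in auto)
    have 4: "(\<Prod>i=1..<Suc r. (-1) ^ dot ((x(Suc r := y)) i) ((x(Suc r := y)) (i + 1))) =
       (-1::real) ^ dot (x r) y * (\<Prod>i=1..<r. (-1) ^ dot (x i) (x (i + 1)))"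
      unfolding ins by (subst prod.insert) (use 2 in auto)
    show ?thesis unfolding 3 4 by (simp only: mult_ac)
  qed
  have PiE: "({1..Suc r} \<rightarrow>\<^sub>E cube n) = (insert (Suc r) {1..r} \<rightarrow>\<^sub>E cube n)"
    by (simp only: ins(1))
  have "(\<Sum>x \<in> {1..Suc r} \<rightarrow>\<^sub>E cube n.
           (\<Prod>i=1..Suc r. f i (x i)) * (\<Prod>i=1..<Suc r. (-1) ^ dot (x i) (x (i + 1))) * G (x (Suc r))) =
     (\<Sum>x \<in> {1..r} \<rightarrow>\<^sub>E cube n.
           (\<Prod>i=1..r. f i (x i)) * (\<Prod>i=1..<r. (-1) ^ dot (x i) (x (i + 1))) * G' (x r))"
    unfolding PiE by (subst sum_PiE_insert, simp, simp only: fun_upd_same key G'_def sum_distrib_left)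
  also have "\<dots> = sqrt 2 ^ (r * n) * (\<Sum>z\<in>cube n. run n f r z * G' z)"
    by (rule Suc.IH)
  also have "(\<Sum>z\<in>cube n. run n f r z * G' z) =
      (\<Sum>y\<in>cube n. \<Sum>z\<in>cube n. f (Suc r) y * G y * ((-1) ^ dot z y * run n f r z))"
    unfolding G'_def sum_distrib_left by (subst sum.swap) (simp add: mult_ac)
  also have "\<dots> = (\<Sum>y\<in>cube n. \<Sum>z\<in>cube n. f (Suc r) y * G y * ((-1) ^ dot y z * run n f r z))"
    by (intro sum.cong refl, subst dot_commute) (auto simp: cube_def)
  also have "\<dots> = (\<Sum>y\<in>cube n. sqrt 2 ^ n * (run n f (Suc r) y * G y))"
    by (intro sum.cong refl) (simp add: hadamard_def flip: sum_distrib_left)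
  finally show ?case by (simp add: sum_distrib_left power_add mult_ac)
qed

text \<open>The exponent \<open>(k + 1) * n / 2\<close> covers the \<open>k\<close> transforms of
  the run and one more, for the inner product with the uniform superposition
  \<open>H |0>\<close>.\<close>

lemma forrelation_run:
  assumes "k \<ge> 1"
  shows "forrelation n k f = (\<Sum>x\<in>cube n. run n f k x) / sqrt 2 ^ n"
proof -
  have "2 powr (real ((k + 1) * n) / 2) = (2 powr (1 / 2)) powr real ((k + 1) * n)"
    by (simp add: powr_powr)
  also have "\<dots> = sqrt 2 ^ ((k + 1) * n)"
    by (subst powr_realpow) (simp_all add: powr_half_sqrt)
  finally have "2 powr (real ((k + 1) * n) / 2) = sqrt 2 ^ (k * n) * sqrt 2 ^ n"
    by (simp add: power_add add_mult_distrib mult_ac)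
  then show ?thesis
    using path_sum[OF assms, where n = n and f = f and G = "\<lambda>_. 1"] by (simp add: forrelation_def)
qed


section \<open>The algorithm\<close>

text \<open>The schedules \<open>a\<close> and \<open>b\<close> give the index of each branch after
  \<open>r\<close> rounds. A single query serves both branches, the index being in superposition.
  Two controlled layers stand for one uncontrolled layer, so that each branch can be followed
  separately.\<close>

definition query_round :: "nat \<Rightarrow> nat \<Rightarrow> (nat \<Rightarrow> nat) \<Rightarrow> (nat \<Rightarrow> nat) \<Rightarrow> nat \<Rightarrow> step list" where
  "query_round L n a b r =
     hadamard_layer L n False @ hadamard_layer L n True @
     index_shift L n False (a r) (a (Suc r)) @ index_shift L n True (b r) (b (Suc r)) @ [Query]"

lemma branch_query_round:
  assumes "L = floorlog 2 k" "1 \<le> k"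
  shows "branch L n \<psi> False (bits L (a r)) u \<Longrightarrow> a (Suc r) \<le> k \<Longrightarrow>
      branch L n (fold (apply_step n k f) (query_round L n a b r) \<psi>) False (bits L (a (Suc r)))
        (\<lambda>x. phase k f (a (Suc r)) x * hadamard n u x)"
    and "branch L n \<psi> True (bits L (b r)) u \<Longrightarrow> b (Suc r) \<le> k \<Longrightarrow>
      branch L n (fold (apply_step n k f) (query_round L n a b r) \<psi>) True (bits L (b (Suc r)))
        (\<lambda>x. phase k f (b (Suc r)) x * hadamard n u x)"
  unfolding query_round_def fold_append o_apply fold_simps
   \<comment> \<open>The rules are nested in the reverse order of the gates; the
     \<open>_other\<close> rules skip the gates of the opposite branch.\<close>
   apply (rule branch_query[OF branch_index_shift_other[OF branch_index_shift[OF
      branch_hadamard_layer_other[OF branch_hadamard_layer]]] _ assms(2,1)]; simp)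
  apply (rule branch_query[OF branch_index_shift[OF branch_index_shift_other[OF
      branch_hadamard_layer[OF branch_hadamard_layer_other]]] _ assms(2,1)]; simp)
  done

text \<open>The weights \<open>c\<close> and \<open>d\<close> left by the first rotation pass
  through unchanged, by linearity of the transform.\<close>

lemma branch_query_rounds:
  assumes "L = floorlog 2 k" "1 \<le> k"
    and "\<And>r. 1 \<le> r \<Longrightarrow> r \<le> m \<Longrightarrow> a r \<le> k" "\<And>r. 1 \<le> r \<Longrightarrow> r \<le> m \<Longrightarrow> b r \<le> k"
    and "branch L n \<psi> False (bits L (a 0)) (\<lambda>x. c * run n g 0 x)"
      "branch L n \<psi> True (bits L (b 0)) (\<lambda>x. d * run n g 0 x)"
  shows "branch L n (fold (apply_step n k f) (concat (map (query_round L n a b) [0..<m])) \<psi>)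
      False (bits L (a m)) (\<lambda>x. c * run n (\<lambda>r. phase k f (a r)) m x) \<and>
    branch L n (fold (apply_step n k f) (concat (map (query_round L n a b) [0..<m])) \<psi>)
      True (bits L (b m)) (\<lambda>x. d * run n (\<lambda>r. phase k f (b r)) m x)"
  using assms(3,4)
proof (induction m)
  case 0
  then show ?case using assms(5,6) by simp
next
  case (Suc m)
  then have "branch L n (fold (apply_step n k f) (concat (map (query_round L n a b) [0..<m])) \<psi>)
      False (bits L (a m)) (\<lambda>x. c * run n (\<lambda>r. phase k f (a r)) m x)"
    "branch L n (fold (apply_step n k f) (concat (map (query_round L n a b) [0..<m])) \<psi>)
      True (bits L (b m)) (\<lambda>x. d * run n (\<lambda>r. phase k f (b r)) m x)"
    by auto
  from branch_query_round(1)[where a = a and r = m, OF assms(1,2) this(1)]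
    branch_query_round(2)[where b = b and r = m, OF assms(1,2) this(2)]
  show ?case using Suc.prems by (simp add: hadamard_scale mult_ac)
qed

text \<open>The indices queried in the second branch. For odd \<open>k\<close> the \<open>m\<close>-th one is 0, where queries
  act trivially.\<close>

definition descending :: "nat \<Rightarrow> nat \<Rightarrow> nat" where
  "descending k r = (if r = 0 \<or> k + 1 < 2 * r + of_bool (odd k) then 0 else k + 1 - r)"

text \<open>The second branch must end with a transform. For odd \<open>k\<close> its idle last
  round provides it; for even \<open>k\<close> it is added after the rounds.\<close>

definition forrelation_steps :: "nat \<Rightarrow> nat \<Rightarrow> step list" where
  "forrelation_steps n k =
     (let L = floorlog 2 k; m = (k + 1) div 2;
          R = Gate1 (L + n) (rmat (rotation_entry (sqrt 3 / 2) (1 / 2)))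
      in R # concat (map (query_round L n id (descending k)) [0..<m]) @
         (if even k then hadamard_layer L n True else []) @
         index_shift L n False m 0 @ index_shift L n True (descending k m) 0 @ [R])"

definition forrelation_algorithm :: "nat \<Rightarrow> nat \<Rightarrow> algorithm" where
  "forrelation_algorithm n k =
     \<lparr>num_qubits = floorlog 2 k + n + 1, steps = forrelation_steps n k, out_qubit = floorlog 2 k + n\<rparr>"

lemma descending_le: "1 \<le> r \<Longrightarrow> descending k r \<le> k"
  by (auto simp: descending_def)

lemma run_descending:
  assumes "1 \<le> k" and m_def: "m = (k + 1) div 2"
    and w_def: "w = run n (\<lambda>r. phase k f (descending k r)) m"
  shows "(if even k then hadamard n w x else w x) = hadamard n (run n (\<lambda>r. f (k + 1 - r)) (k - m)) x"
proof -
  \<comment> \<open>Among the rounds \<open>1, ..., m\<close>, those with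
    \<open>r \<le> k - m\<close> are exactly the ones in which the second branch is not
    idle.\<close>
  have eq: "phase k f (descending k r) = f (k + 1 - r)" if "1 \<le> r" "r \<le> k - m" for r
    using that assms(1) by (auto simp: phase_def descending_def m_def fun_eq_iff elim!: evenE oddE)
  show ?thesis
  proof (cases "even k")
    case True
    then have "k - m = m" by (auto simp: m_def elim!: evenE)
    then show ?thesis using True run_cong[of m, OF eq] by (simp add: w_def)
  next
    case False
    then have m: "m = Suc (k - m)" by (auto simp: m_def elim!: oddE)
    have "descending k m = 0" using False by (auto simp: m_def descending_def elim!: oddE)
    then have "phase k f (descending k m) x = 1" by (simp add: phase_def)
    moreover have "w x = phase k f (descending k m) x *
        hadamard n (run n (\<lambda>r. phase k f (descending k r)) (k - m)) x"
      \<comment> \<open>As a rewrite rule the equation for \<open>m\<close> would loop. It is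
        applied only to the length of the run and to the index of its last query.\<close>
      unfolding w_def by (subst (1) m, subst (2) m) (simp only: run.simps)
    ultimately show ?thesis using False run_cong[of "k - m", OF eq] by simp
  qed
qed

section \<open>Interference of the branches and output probabilities\<close>

lemma output_prob_sum:
  assumes "num_qubits A = L + n + 1" "out_qubit A = L + n"
  shows "output_prob n k A f v =
     (\<Sum>a\<in>cube L. \<Sum>x\<in>cube n. (cmod (final_state n k A f (a @ x @ [v])))\<^sup>2)"
proof -
  have "output_prob n k A f v = (\<Sum>b\<in>cube (Suc (L + n)).
      if b ! (L + n) = v then (cmod (final_state n k A f b))\<^sup>2 else 0)"
    unfolding output_prob_def assms by (subst sum.inter_filter) simp_all
  also have "\<dots> = (\<Sum>c\<in>UNIV. \<Sum>b\<in>cube (L + n).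
      if c = v then (cmod (final_state n k A f (b @ [c])))\<^sup>2 else 0)"
    unfolding sum_cube_Suc_snoc by (intro sum.cong refl) (auto simp: cube_def nth_append)
  also have "\<dots> = (\<Sum>b\<in>cube (L + n). (cmod (final_state n k A f (b @ [v])))\<^sup>2)"
    by (cases v) (simp_all add: UNIV_bool)
  finally show ?thesis by (simp add: sum_cube_append)
qed

text \<open>Branches with different register contents are orthogonal and would not interfere, so
  both return to index 0.\<close>

lemma branch_reset:
  assumes "branch L n \<psi> False (bits L i) u" "branch L n \<psi> True (bits L j) w"
    and \<psi>'_def: "\<psi>' = fold (apply_step n k f) (index_shift L n False i 0 @ index_shift L n True j 0) \<psi>"
  shows "branch L n \<psi>' False (bits L 0) u" "branch L n \<psi>' True (bits L 0) w"
  unfolding \<psi>'_def fold_append o_apply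
   apply (rule branch_index_shift_other[OF branch_index_shift[OF assms(1)]], simp)
  apply (rule branch_index_shift[OF branch_index_shift_other[OF assms(2)]], simp)
  done


text \<open>The control starts in \<open>False\<close>, so the first gate distributes the weights in
  that column of \<open>g\<close>.\<close>

lemma branch_initial:
  fixes L n
  defines "\<psi> \<equiv> \<lambda>b. of_bool (b = replicate (L + n + 1) False)"
  shows "branch L n (apply_step m k f (Gate1 (L + n) (rmat g)) \<psi>) s (bits L 0)
    (\<lambda>x. g s False * run n h 0 x)"
  unfolding branch_def
proof (intro ballI)
  fix a x assume a: "a \<in> cube L" and x: "x \<in> cube n"
  have "replicate (L + n + 1) False = replicate L False @ replicate n False @ [False]"
    by (simp add: replicate_add replicate_append_same)
  then have \<psi>: "\<psi> (a @ x @ [c]) = of_bool (a = replicate L False \<and> x = replicate n False \<and> \<not> c)" for c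
    using a x by (simp add: \<psi>_def cube_def)
  have upd: "(a @ x @ [s])[L + n := c] = a @ x @ [c]" for c
    using a x by (simp add: cube_def list_update_append)
  have "bits L 0 = replicate L False" by (auto intro!: nth_equalityI simp: bits_def)
  then show "apply_step m k f (Gate1 (L + n) (rmat g)) \<psi> (a @ x @ [s]) =
      of_bool (a = bits L 0) * complex_of_real (g s False * run n h 0 x)"
    unfolding apply_gate1 upd \<psi> nth_control[OF a x] by (simp add: UNIV_bool)
qed

text \<open>With equal register contents, the gate on the control combines the amplitudes pointwise,
  with row \<open>s\<close> of \<open>g\<close> as coefficients.\<close>

lemma interference:
  assumes "branch L n \<psi> False i u" "branch L n \<psi> True i w" "i \<in> cube L"
  shows "(\<Sum>a\<in>cube L. \<Sum>x\<in>cube n.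
      (cmod (apply_step m k f (Gate1 (L + n) (rmat g)) \<psi> (a @ x @ [s])))\<^sup>2) =
    (\<Sum>x\<in>cube n. (g s False * u x + g s True * w x)\<^sup>2)"
proof -
  have "apply_step m k f (Gate1 (L + n) (rmat g)) \<psi> (a @ x @ [s]) =
      of_bool (a = i) * complex_of_real (g s False * u x + g s True * w x)"
    if a: "a \<in> cube L" and x: "x \<in> cube n" for a x
  proof -
    have upd: "(a @ x @ [s])[L + n := c] = a @ x @ [c]" for c
      using a x by (simp add: cube_def list_update_append)
    show ?thesis
      using assms(1,2) a x unfolding apply_gate1 upd nth_control[OF a x]
      by (simp add: branch_def UNIV_bool algebra_simps)
  qed
  then have "(\<Sum>a\<in>cube L. \<Sum>x\<in>cube n.
      (cmod (apply_step m k f (Gate1 (L + n) (rmat g)) \<psi> (a @ x @ [s])))\<^sup>2) =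
    (\<Sum>a\<in>cube L. of_bool (a = i) * (\<Sum>x\<in>cube n. (g s False * u x + g s True * w x)\<^sup>2))"
    by (intro sum.cong refl) (simp add: norm_mult power_mult_distrib flip: of_real_add of_real_mult)
  then show ?thesis
    using assms(3) by (simp add: of_bool_def if_distrib[of "\<lambda>t. t * _"] cong: if_cong)
qed

lemma output_prob_forrelation_algorithm:
  assumes k: "1 \<le> k" and f: "boolean_functions n k f"
  shows "output_prob n k (forrelation_algorithm n k) f True = 3 / 8 + 3 / 8 * forrelation n k f"
    and "output_prob n k (forrelation_algorithm n k) f False = 5 / 8 - 3 / 8 * forrelation n k f"
proof -
  define L m g where "L = floorlog 2 k" and "m = (k + 1) div 2" and "g = rotation_entry (sqrt 3 / 2) (1 / 2)"
  define \<psi>1 where "\<psi>1 = apply_step n k f (Gate1 (L + n) (rmat g))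
    (\<lambda>b. of_bool (b = replicate (L + n + 1) False))"
  define \<psi>2 where "\<psi>2 = fold (apply_step n k f) (concat (map (query_round L n id (descending k)) [0..<m])) \<psi>1"
  define \<psi>3 where "\<psi>3 = fold (apply_step n k f) (if even k then hadamard_layer L n True else []) \<psi>2"
  define \<psi>4 where "\<psi>4 = fold (apply_step n k f)
    (index_shift L n False m 0 @ index_shift L n True (descending k m) 0) \<psi>3"
  define v where "v = run n (\<lambda>r. phase k f (id r)) m"
  define w0 where "w0 = run n (\<lambda>r. phase k f (descending k r)) m"
  define w where "w x = (if even k then hadamard n w0 x else w0 x)" for x
  have mk: "m \<le> k" using k by (simp add: m_def)
  have "branch L n \<psi>2 False (bits L (id m)) (\<lambda>x. g False False * v x) \<and>
      branch L n \<psi>2 True (bits L (descending k m)) (\<lambda>x. g True False * w0 x)"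
    unfolding \<psi>2_def v_def w0_def
  proof (rule branch_query_rounds[OF L_def k])
    \<comment> \<open>\<open>run n g 0\<close> is \<open>|0>\<close> for every \<open>g\<close>, so
      \<open>undefined\<close> can stand for \<open>g\<close>.\<close>
    show "branch L n \<psi>1 False (bits L (id 0)) (\<lambda>x. g False False * run n undefined 0 x)"
      "branch L n \<psi>1 True (bits L (descending k 0)) (\<lambda>x. g True False * run n undefined 0 x)"
      using branch_initial unfolding \<psi>1_def by (simp_all add: descending_def del: run.simps)
  qed (use mk descending_le in auto)
  then have "branch L n \<psi>3 False (bits L m) (\<lambda>x. g False False * v x)"
    "branch L n \<psi>3 True (bits L (descending k m)) (\<lambda>x. g True False * w x)"
    unfolding \<psi>3_def w_def
    using branch_hadamard_layer_other[of L n \<psi>2 False] branch_hadamard_layer[of L n \<psi>2 True]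
    by (auto simp flip: hadamard_scale)
  from branch_reset[OF this \<psi>4_def]
  have \<psi>4: "branch L n \<psi>4 False (bits L 0) (\<lambda>x. g False False * v x)"
    "branch L n \<psi>4 True (bits L 0) (\<lambda>x. g True False * w x)" .
  have fin: "final_state n k (forrelation_algorithm n k) f = apply_step n k f (Gate1 (L + n) (rmat g)) \<psi>4"
    unfolding final_state_def forrelation_algorithm_def forrelation_steps_def Let_def
      \<psi>4_def \<psi>3_def \<psi>2_def \<psi>1_def
    by (simp add: L_def m_def g_def)
  have bits: "bits L 0 \<in> cube L" by (simp add: bits_def cube_def)
  have out: "output_prob n k (forrelation_algorithm n k) f s =
      (\<Sum>x\<in>cube n. (g s False * (g False False * v x) + g s True * (g True False * w x))\<^sup>2)" for s
    unfolding interference[OF \<psi>4 bits, where m = n and k = k and f = f, symmetric] fin[symmetric]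
    by (rule output_prob_sum) (simp_all add: forrelation_algorithm_def L_def)
  have sq: "(phase k f i x)\<^sup>2 = 1" if "x \<in> cube n" for i x
  proof (cases "i \<in> {1..k}")
    case True
    then have "f i x \<in> {-1, 1}" using f that unfolding boolean_functions_def by blast
    then show ?thesis using True by (auto simp: phase_def)
  next
    case False
    then show ?thesis by (auto simp: phase_def)
  qed
  have v2: "(\<Sum>x\<in>cube n. (v x)\<^sup>2) = 1"
    unfolding v_def by (rule run_norm) (rule sq)
  have "(\<Sum>x\<in>cube n. (w0 x)\<^sup>2) = 1"
    unfolding w0_def by (rule run_norm) (rule sq)
  then have w2: "(\<Sum>x\<in>cube n. (w x)\<^sup>2) = 1"
    by (cases "even k") (simp_all add: w_def hadamard_parseval)
  have v: "v = run n f m"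
    unfolding v_def by (rule run_cong) (use mk in \<open>auto simp: phase_def fun_eq_iff\<close>)
  \<comment> \<open>Here \<open>m\<close> is written as \<open>k - (k - m)\<close>, to fit
    \<open>run_meet\<close> with \<open>j = k - m\<close>.\<close>
  have "(\<Sum>x\<in>cube n. v x * w x) =
      (\<Sum>x\<in>cube n. run n f (k - (k - m)) x * hadamard n (run n (\<lambda>r. f (k + 1 - r)) (k - m)) x)"
    unfolding w_def run_descending[OF k m_def w0_def] v using mk by simp
  also have "\<dots> = forrelation n k f"
    using run_meet[of "k - m" k n f] forrelation_run[OF k, of n f] by simp
  finally have vw: "(\<Sum>x\<in>cube n. v x * w x) = forrelation n k f" .
  \<comment> \<open>The squared norm of a combination of two unit vectors with inner product
    \<Phi>.\<close>
  have expand: "(\<Sum>x\<in>cube n. (p * v x + q * w x)\<^sup>2) = p\<^sup>2 + q\<^sup>2 + 2 * p * q * forrelation n k f" for p q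
  proof -
    have "(\<Sum>x\<in>cube n. (p * v x + q * w x)\<^sup>2) =
        (\<Sum>x\<in>cube n. p\<^sup>2 * (v x)\<^sup>2 + q\<^sup>2 * (w x)\<^sup>2 + 2 * p * q * (v x * w x))"
      by (intro sum.cong refl) (simp add: power2_eq_square algebra_simps)
    then show ?thesis
      by (simp add: sum.distrib v2 w2 vw flip: sum_distrib_left)
  qed
  have out': "output_prob n k (forrelation_algorithm n k) f s =
      (g s False * g False False)\<^sup>2 + (g s True * g True False)\<^sup>2 +
      2 * (g s False * g False False) * (g s True * g True False) * forrelation n k f" for s
    unfolding out by (simp only: expand flip: mult.assoc)
  \<comment> \<open>The coefficients of \<open>v\<close> and \<open>w\<close> are both
    \<open>sqrt 3 / 4\<close>.\<close>
  show "output_prob n k (forrelation_algorithm n k) f True = 3 / 8 + 3 / 8 * forrelation n k f"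
    unfolding out' by (simp add: g_def rotation_entry_def power2_eq_square)
  \<comment> \<open>The coefficients are \<open>3 / 4\<close> and \<open>- 1 / 4\<close>.\<close>
  show "output_prob n k (forrelation_algorithm n k) f False = 5 / 8 - 3 / 8 * forrelation n k f"
    unfolding out' by (simp add: g_def rotation_entry_def power2_eq_square)
qed

lemma valid_forrelation_algorithm:
  assumes "1 \<le> k"
  shows "valid_algorithm n k (forrelation_algorithm n k)"
proof -
  define L where "L = floorlog 2 k"
  have "orthogonal_entries (rotation_entry (sqrt 3 / 2) (1 / 2))"
    by (rule orthogonal_rotation) (simp add: power2_eq_square)
  then have "valid_step (L + n + 1) s" if "s \<in> set (forrelation_steps n k)" for s
    using that unfolding forrelation_steps_def Let_def L_def[symmetric]
    by (auto simp: query_round_def hadamard_layer_def index_shift_def unitary_rmat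
        orthogonal_not orthogonal_hadamard intro!: valid_cgate split: if_splits)
  then show ?thesis by (simp add: valid_algorithm_def forrelation_algorithm_def L_def)
qed


section \<open>Counting gates\<close>

text \<open>The Hamming distance of the lowest \<open>L\<close> bits, which is the gate count of an
  index shift.\<close>

definition bit_changes :: "nat \<Rightarrow> nat \<Rightarrow> nat \<Rightarrow> nat" where
  "bit_changes L i j = length (filter (\<lambda>q. bit i q \<noteq> bit j q) [0..<L])"

lemma bit_changes_Suc:
  "bit_changes (Suc L) i j = of_bool (odd i \<noteq> odd j) + bit_changes L (i div 2) (j div 2)"
proof -
  have "[0..<Suc L] = 0 # map Suc [0..<L]" by (simp only: upt_conv_Cons map_Suc_upt zero_less_Suc)
  then show ?thesis by (simp add: bit_changes_def filter_map o_def bit_Suc bit_0 del: upt_Suc)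
qed

lemma bit_changes_le: "bit_changes L i j \<le> L"
  using length_filter_le[of _ "[0..<L]"] by (simp add: bit_changes_def)

lemma bit_changes_commute: "bit_changes L i j = bit_changes L j i"
  unfolding bit_changes_def by (intro arg_cong[where f = length] filter_cong) auto

lemma bit_changes_self [simp]: "bit_changes L i i = 0"
  by (simp add: bit_changes_def)

text \<open>The number \<open>bit_changes L 0 i\<close> of ones of \<open>i\<close> is the potential of the amortised analysis.\<close>

lemma bit_changes_increment:
  "bit_changes L i (Suc i) + bit_changes L 0 (Suc i) \<le> bit_changes L 0 i + 2"
proof (induction L arbitrary: i)
  case 0
  then show ?case by (simp add: bit_changes_def)
next
  case (Suc L)
  show ?case
  proof (cases "even i")
    case True
    \<comment> \<open>No carry: one flip, and one more 1.\<close>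
    then have "Suc i div 2 = i div 2" by simp
    then show ?thesis using True by (simp add: bit_changes_Suc)
  next
    case False
    \<comment> \<open>The lowest bit turns from 1 to 0, so the lost 1 pays for the flip; the carry
      increments \<open>i div 2\<close>.\<close>
    then have "Suc i div 2 = Suc (i div 2)" by (auto elim!: oddE)
    then show ?thesis using False Suc.IH[of "i div 2"] by (simp add: bit_changes_Suc)
  qed
qed

text \<open>The amortised bound 2 per increment telescopes, with potential 0 at the start.\<close>

lemma bit_changes_ascending: "(\<Sum>r<m. bit_changes L r (Suc r)) + bit_changes L 0 m \<le> 2 * m"
proof (induction m)
  case (Suc m)
  then show ?case using bit_changes_increment[of L m] by simp
qed simp

text \<open>Decrements are increments read backwards, so the potential now appears at the end of the
  sum. Writing the first index costs its number of ones. The last step may be a jump to 0 and is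
  bounded by \<open>L\<close> on its own.\<close>

lemma bit_changes_descending:
  assumes "1 \<le> k"
  shows "(\<Sum>r<(k + 1) div 2. bit_changes L (descending k r) (descending k (Suc r))) \<le> k + 1 + 2 * L"
proof -
  define d where "d = descending k"
  have "(\<Sum>r<j. bit_changes L (d r) (d (Suc r))) \<le> 2 * j + bit_changes L 0 (d j)"
    if "2 * j + 1 \<le> k" for j
    using that
  proof (induction j)
    case 0
    then show ?case by simp
  next
    case (Suc j)
    show ?case
    proof (cases "j = 0")
      case True
      then show ?thesis by (simp add: d_def descending_def)
    next
      case False
      \<comment> \<open>The bound on \<open>j\<close> stops before the last round, so this is a
        genuine decrement.\<close>
      then have "d j = Suc (d (Suc j))"
        using Suc.prems by (simp add: d_def descending_def Suc_diff_le)
      then show ?thesis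
        using Suc bit_changes_increment[of L "d (Suc j)"] bit_changes_commute[of L "d j" "d (Suc j)"] by simp
    qed
  qed
  note sum = this
  obtain j where j: "(k + 1) div 2 = Suc j" "2 * j + 1 \<le> k"
    using assms by (cases "(k + 1) div 2") auto
  have "(\<Sum>r<Suc j. bit_changes L (d r) (d (Suc r))) \<le> 2 * j + L + L"
    using sum[OF j(2)] bit_changes_le[of L 0 "d j"] bit_changes_le[of L "d j" "d (Suc j)"] by simp
  then show ?thesis using j by (simp add: d_def)
qed

lemma cgate_neq_Query [simp]: "cgate p s q g \<noteq> Query"
  by (simp add: cgate_def)

lemma filter_Query_layer [simp]:
  "filter (\<lambda>s. s = Query) (hadamard_layer L n b) = []"
  "filter (\<lambda>s. s \<noteq> Query) (hadamard_layer L n b) = hadamard_layer L n b"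
  "filter (\<lambda>s. s = Query) (index_shift L n b i j) = []"
  "filter (\<lambda>s. s \<noteq> Query) (index_shift L n b i j) = index_shift L n b i j"
  by (auto simp: hadamard_layer_def index_shift_def filter_empty_conv filter_id_conv)

lemma length_layer [simp]:
  "length (hadamard_layer L n b) = n" "length (index_shift L n b i j) = bit_changes L i j"
  by (simp_all add: hadamard_layer_def index_shift_def bit_changes_def)

lemma num_queries_forrelation_algorithm:
  "num_queries (forrelation_algorithm n k) = (k + 1) div 2"
proof -
  have "length (filter (\<lambda>s. s = Query) (concat (map (query_round L n a b) [0..<m]))) = m" for L a b m
    by (induction m) (simp_all add: query_round_def)
  then show ?thesis
    by (simp add: num_queries_def forrelation_algorithm_def forrelation_steps_def Let_def)
qed

lemma num_gates_forrelation_algorithm: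
  assumes n: "1 \<le> n" and k: "1 \<le> k"
  shows "num_gates (forrelation_algorithm n k) \<le> 20 * (n * k)"
proof -
  define L m where "L = floorlog 2 k" and "m = (k + 1) div 2"
  have rounds: "length (filter (\<lambda>s. s \<noteq> Query) (concat (map (query_round L n a b) [0..<m]))) =
      2 * n * m + (\<Sum>r<m. bit_changes L (a r) (a (Suc r))) + (\<Sum>r<m. bit_changes L (b r) (b (Suc r)))"
    for a b m
    by (induction m) (simp_all add: query_round_def)
  have "num_gates (forrelation_algorithm n k) = 2 + 2 * n * m + (\<Sum>r<m. bit_changes L r (Suc r)) +
      (\<Sum>r<m. bit_changes L (descending k r) (descending k (Suc r))) + (if even k then n else 0) +
      bit_changes L m 0 + bit_changes L (descending k m) 0"
    unfolding num_gates_def forrelation_algorithm_def forrelation_steps_def Let_def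
      L_def[symmetric] m_def[symmetric]
    by (simp add: rounds)
  also have "\<dots> \<le> 2 + 2 * n * m + 2 * m + (k + 1 + 2 * L) + n + L + L"
    using bit_changes_ascending[of L m] bit_changes_descending[OF k, of L, folded m_def]
      bit_changes_le[of L m 0] bit_changes_le[of L "descending k m" 0] by (simp split: if_split)
  \<comment> \<open>The crude bound \<open>L \<le> k\<close> suffices, as \<open>L\<close> enters
    only a constant number of times. Bounding every term by a multiple of \<open>n * k\<close> gives
    13, so 20 leaves room.\<close>
  also have "\<dots> \<le> 20 * (n * k)"
  proof -
    have m: "m \<le> k" using k by (simp add: m_def)
    have "L \<le> k" unfolding L_def by (rule floorlog_leI) (simp_all add: less_exp)
    moreover have "k \<le> n * k" "n \<le> n * k" "1 \<le> n * k" "n * m \<le> n * k" using n k m by simp_all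
    ultimately show ?thesis using m by linarith
  qed
  finally show ?thesis .
qed

theorem proposition6:
  shows "\<exists>C::real. \<forall>n\<ge>1. \<forall>k\<ge>1. \<exists>A.
           valid_algorithm n k A \<and>
           num_queries A = nat \<lceil>real k / 2\<rceil> \<and>
           real (num_gates A) \<le> C * (real n * real k) \<and>
           solves_forrelation n k 0.4 A"
proof (intro exI allI impI conjI)
  fix n k :: nat assume n: "n \<ge> 1" and k: "k \<ge> 1"
  let ?A = "forrelation_algorithm n k"
  show "valid_algorithm n k ?A" using k by (rule valid_forrelation_algorithm)
  have "\<lceil>real k / 2\<rceil> = int ((k + 1) div 2)"
    by (rule ceiling_unique) linarith+
  then show "num_queries ?A = nat \<lceil>real k / 2\<rceil>"
    by (simp add: num_queries_forrelation_algorithm)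
  show "real (num_gates ?A) \<le> 20 * (real n * real k)"
    using of_nat_mono[OF num_gates_forrelation_algorithm[OF n k], where 'a = real] by simp
  show "solves_forrelation n k 0.4 ?A"
    unfolding solves_forrelation_def
  proof (intro allI impI conjI)
    fix f assume f: "boolean_functions n k f"
    note out = output_prob_forrelation_algorithm[OF k f]
    \<comment> \<open>At \<Phi> = 3/5 the error is exactly 5/8 - 9/40 = 2/5.\<close>
    show "output_prob n k ?A f False \<le> 0.4" if "forrelation n k f \<ge> 3 / 5"
      unfolding out using that by simp
    \<comment> \<open>Here the error is at most 3/8 + 3/800 = 303/800.\<close>
    show "output_prob n k ?A f True \<le> 0.4" if "\<bar>forrelation n k f\<bar> \<le> 1 / 100"
      unfolding out using that by (simp add: abs_le_iff)
  qed
qed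

end
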